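(* Let $\mathcal{B}=\{(i,k): k>1,\ 0\le i\le k-1\}$ and, for $B\subset\mathcal{B}$, let $P_B$ be the graph with vertex set $\mathbb{Z}$ defined in the context. The collection $\mathcal{P}=\{P_B: B\subset\mathcal{B},\ P_B\text{ has bounded degree}\}$ is an uncountable family of harmonically labeled graphs; that is, the set $\mathcal{P}$ of graphs on the vertex set $\mathbb{Z}$ is uncountable, and for each $P_B\in\mathcal{P}$ the identity map $\mathbb{Z}\to\mathbb{Z}$ is a harmonic labeling of $P_B$.
   Context: A harmonic labeling of an infinite simple graph $G=(V,E)$ of bounded degree is a bijection $\ell:V\to\mathbb{Z}$ such that $\ell(v)=\frac{1}{\deg(v)}\sum_{\{v,w\}\in E}\ell(w)$ for every $v\in V$. The pairs $(i,k)\in\mathcal{B}$ consist of integers. For a (finite or infinite) subset $B\subset\mathcal{B}$, $P_B$ is the simple graph with vertex set $\mathbb{Z}$ and edges $\{n,n+1\}$ for all $n\in\mathbb{Z}$, together with the edges $\{(s+1)k+i,\ sk+i\}$ for every $s\in\mathbb{Z}$ and every $(i,k)\in B$. Each vertex $n\in\mathbb{Z}$ of $P_B$ is labeled by itself. *)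

theory Defs
  imports Complex_Main "HOL-Library.Countable_Set"
begin

type_synonym 'a ugraph = "'a set \<times> 'a set set"

definition simple_graph :: "'a ugraph \<Rightarrow> bool" where
  "simple_graph G \<longleftrightarrow> (\<forall>e\<in>snd G. e \<subseteq> fst G \<and> card e = 2)"

definition neighbors :: "'a ugraph \<Rightarrow> 'a \<Rightarrow> 'a set" where
  "neighbors G v = {w \<in> fst G. {v, w} \<in> snd G}"

text \<open>In a simple graph the edges at a vertex correspond one-to-one to its neighbors.\<close>

definition degree :: "'a ugraph \<Rightarrow> 'a \<Rightarrow> nat" where
  "degree G v = card (neighbors G v)"

text \<open>Finiteness is required separately because the cardinality of an infinite set is 0.\<close>

definition bounded_degree :: "'a ugraph \<Rightarrow> bool" where
  "bounded_degree G \<longleftrightarrow> (\<exists>D. \<forall>v\<in>fst G. finite (neighbors G v) \<and> degree G v \<le> D)"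

text \<open>
  The standing assumptions on the graph are part of the predicate. Isolated vertices are
  excluded because the mean over their neighbors is undefined, whereas division by 0
  yields 0 here.
\<close>

definition harmonic_labeling :: "'a ugraph \<Rightarrow> ('a \<Rightarrow> int) \<Rightarrow> bool" where
  "harmonic_labeling G l \<longleftrightarrow>
     simple_graph G \<and> infinite (fst G) \<and> bounded_degree G \<and>
     bij_betw l (fst G) UNIV \<and>
     (\<forall>v\<in>fst G. degree G v \<noteq> 0 \<and>
        real_of_int (l v) = 1 / real (degree G v) * (\<Sum>w\<in>neighbors G v. real_of_int (l w)))"

definition all_pairs :: "(int \<times> int) set" where
  "all_pairs = {(i, k). k > 1 \<and> 0 \<le> i \<and> i \<le> k - 1}"

definition P_graph :: "(int \<times> int) set \<Rightarrow> int ugraph" where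
  "P_graph B = (UNIV,
     {{n, n + 1} | n. True} \<union> {{(s + 1) * k + i, s * k + i} | s i k. (i, k) \<in> B})"

definition P_family :: "int ugraph set" where
  "P_family = {P_graph B | B. B \<subseteq> all_pairs \<and> bounded_degree (P_graph B)}"

end

theory Submission
  imports Defs
begin

text \<open>
  A pair \<open>(i, k)\<close> joins each member of the residue class \<open>i\<close> modulo \<open>k\<close> to both of its
  neighbours at distance \<open>k\<close> in that class, just as the path edges join each integer to both of
  its neighbours at distance 1. The neighbourhood of a vertex \<open>v\<close> is therefore
  invariant under the reflection \<open>w \<mapsto> 2 * v - w\<close>, so its mean is \<open>v\<close>: the identity is harmonic
  on every graph of the family (lemma \<open>harmonic_labeling_P_graph\<close>).

  For uncountability, consider the residue classes \<open>2 ^ m\<close> modulo \<open>2 ^ (m + 1)\<close>. The class with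
  index \<open>m\<close> consists of the integers of 2-adic valuation \<open>m\<close>, so these classes are pairwise
  disjoint, and any set of them yields a graph of maximal degree at most 4
  (lemma \<open>bounded_degree_dyadic\<close>). Different sets of indices give different graphs, because the
  distance \<open>2 ^ (m + 1)\<close> between the ends of an edge reveals the class that the edge comes from
  (lemma \<open>dyadic_edge_iff\<close>). This embeds the power set of the natural numbers into the family.
\<close>

text \<open>
  This description makes the reflection symmetry visible: \<open>w\<close> enters only through its distance
  from \<open>v\<close>. It does not matter which end of an edge is tested for membership in the residue
  class, since the two ends differ by the modulus.
\<close>

lemma neighbors_P_graph:
  assumes "B \<subseteq> all_pairs"
  shows "neighbors (P_graph B) v =
    {w. \<bar>w - v\<bar> = 1 \<or> (\<exists>i. (i, \<bar>w - v\<bar>) \<in> B \<and> \<bar>w - v\<bar> dvd v - i)}"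
proof -
  have path: "(\<exists>n. {v, w} = {n, n + 1}) \<longleftrightarrow> \<bar>w - v\<bar> = 1" for w
    unfolding doubleton_eq_iff by presburger
  have chords: "(\<exists>s i k. {v, w} = {(s + 1) * k + i, s * k + i} \<and> (i, k) \<in> B) \<longleftrightarrow>
      (\<exists>i. (i, \<bar>w - v\<bar>) \<in> B \<and> \<bar>w - v\<bar> dvd v - i)" for w
  proof
    assume "\<exists>s i k. {v, w} = {(s + 1) * k + i, s * k + i} \<and> (i, k) \<in> B"
    then obtain s i k where e: "{v, w} = {(s + 1) * k + i, s * k + i}" and ik: "(i, k) \<in> B"
      by blast
    have k: "k > 1"
      using ik assms by (auto simp: all_pairs_def)
    from e consider "v = (s + 1) * k + i" "w = s * k + i"
      | "v = s * k + i" "w = (s + 1) * k + i"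
      unfolding doubleton_eq_iff by blast
    then have "\<bar>w - v\<bar> = k \<and> k dvd v - i"
      using k by cases (simp_all add: algebra_simps)
    then show "\<exists>i. (i, \<bar>w - v\<bar>) \<in> B \<and> \<bar>w - v\<bar> dvd v - i"
      using ik by blast
  next
    assume "\<exists>i. (i, \<bar>w - v\<bar>) \<in> B \<and> \<bar>w - v\<bar> dvd v - i"
    then obtain i where "(i, \<bar>w - v\<bar>) \<in> B" and "\<bar>w - v\<bar> dvd v - i"
      by blast
    moreover define k where "k = \<bar>w - v\<bar>"
    ultimately have ik: "(i, k) \<in> B" and "k dvd v - i"
      by simp_all
    then obtain c where "v - i = k * c"
      by auto
    then have v: "v = c * k + i"
      by (simp add: algebra_simps)
    consider "w = v + k" | "w = v - k"
      unfolding k_def by linarith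
    then have "\<exists>s. {v, w} = {(s + 1) * k + i, s * k + i}"
    proof cases
      case 1
      then have "w = (c + 1) * k + i"
        using v by (simp add: algebra_simps)
      then show ?thesis
        using v by blast
    next
      case 2
      then have "v = ((c - 1) + 1) * k + i" and "w = (c - 1) * k + i"
        using v by (simp_all add: algebra_simps)
      then show ?thesis
        by blast
    qed
    then show "\<exists>s i k. {v, w} = {(s + 1) * k + i, s * k + i} \<and> (i, k) \<in> B"
      using ik by blast
  qed
  show ?thesis
    unfolding neighbors_def P_graph_def fst_conv snd_conv Un_iff mem_Collect_eq simp_thms path chords
    by simp
qed

lemma simple_graph_P_graph:
  assumes "B \<subseteq> all_pairs"
  shows "simple_graph (P_graph B)"
proof -
  have "card {(s + 1) * k + i, s * k + i} = 2" if "(i, k) \<in> B" for s i k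
  proof -
    have "k > 1"
      using that assms by (auto simp: all_pairs_def)
    then show ?thesis
      by (simp add: algebra_simps)
  qed
  then show ?thesis
    by (auto simp: simple_graph_def P_graph_def)
qed

text \<open>
  Summing once over \<open>w\<close> and once over the mirror images \<open>2 * v - w\<close> shows that twice the sum is
  \<open>2 * v\<close> times the number of summands.
\<close>

lemma sum_reflection_invariant:
  fixes N :: "int set"
  assumes "\<And>w. w \<in> N \<Longrightarrow> 2 * v - w \<in> N"
  shows "(\<Sum>w\<in>N. real_of_int w) = real (card N) * real_of_int v"
proof -
  have "(\<Sum>w\<in>N. real_of_int w) = (\<Sum>w\<in>N. real_of_int (2 * v - w))"
    by (rule sum.reindex_bij_witness[where i = "\<lambda>w. 2 * v - w" and j = "\<lambda>w. 2 * v - w"])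
      (use assms in auto)
  also have "\<dots> = 2 * real (card N) * real_of_int v - (\<Sum>w\<in>N. real_of_int w)"
    by (simp add: sum_subtractf)
  finally show ?thesis by simp
qed

lemma harmonic_labeling_P_graph:
  assumes B: "B \<subseteq> all_pairs" and bd: "bounded_degree (P_graph B)"
  shows "harmonic_labeling (P_graph B) id"
proof -
  have verts: "fst (P_graph B) = UNIV"
    by (simp add: P_graph_def)
  have "degree (P_graph B) v \<noteq> 0 \<and> real_of_int (id v) =
      1 / real (degree (P_graph B) v) * (\<Sum>w\<in>neighbors (P_graph B) v. real_of_int (id w))" for v
  proof -
    let ?N = "neighbors (P_graph B) v"
    have "finite ?N"
      using bd verts by (auto simp: bounded_degree_def)
    moreover have "v + 1 \<in> ?N"
      by (simp add: neighbors_P_graph[OF B])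
    ultimately have nz: "card ?N \<noteq> 0"
      by auto
    have "2 * v - w \<in> ?N" if "w \<in> ?N" for w
    proof -
      have "\<bar>(2 * v - w) - v\<bar> = \<bar>w - v\<bar>"
        by simp
      then show ?thesis
        using that unfolding neighbors_P_graph[OF B] mem_Collect_eq by (simp only:)
    qed
    then have "(\<Sum>w\<in>?N. real_of_int w) = real (card ?N) * real_of_int v"
      by (rule sum_reflection_invariant)
    then show ?thesis
      using nz by (simp add: degree_def)
  qed
  then show ?thesis
    unfolding harmonic_labeling_def verts
    using simple_graph_P_graph[OF B] bd infinite_UNIV_int bij_id by blast
qed

definition dyadic_pairs :: "nat set \<Rightarrow> (int \<times> int) set" where
  "dyadic_pairs S = (\<lambda>m. (2 ^ m, 2 ^ (m + 1))) ` S"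

lemma dyadic_pairs_subset: "dyadic_pairs S \<subseteq> all_pairs"
proof -
  have "(1::int) < 2 ^ (m + 1)" and "(2::int) ^ m \<le> 2 ^ (m + 1) - 1" for m
    using one_less_power[of "2::int" "m + 1"] by auto
  then show ?thesis
    by (auto simp: dyadic_pairs_def all_pairs_def)
qed

lemma neighbors_dyadic:
  "neighbors (P_graph (dyadic_pairs S)) v =
    {w. \<bar>w - v\<bar> = 1 \<or> (\<exists>m\<in>S. \<bar>w - v\<bar> = 2 ^ (m + 1) \<and> 2 ^ (m + 1) dvd v - 2 ^ m)}"
proof -
  have "(\<exists>i. (i, d) \<in> dyadic_pairs S \<and> d dvd v - i) \<longleftrightarrow>
      (\<exists>m\<in>S. d = 2 ^ (m + 1) \<and> 2 ^ (m + 1) dvd v - 2 ^ m)" for d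
    by (auto simp: dyadic_pairs_def image_iff)
  then show ?thesis
    unfolding neighbors_P_graph[OF dyadic_pairs_subset] by (simp only:)
qed

text \<open>
  Both hypotheses say that the 2-adic valuation of \<open>v\<close> is the respective exponent.
\<close>

lemma dyadic_class_unique:
  fixes v :: int
  assumes "2 ^ (m + 1) dvd v - 2 ^ m" and "2 ^ (n + 1) dvd v - 2 ^ n"
  shows "m = n"
proof -
  have no_less: False
    if "a < b" "2 ^ (a + 1) dvd v - 2 ^ a" "2 ^ (b + 1) dvd v - 2 ^ b" for a b :: nat
  proof -
    have pb: "(2::int) ^ (a + 1) dvd 2 ^ b"
      by (rule le_imp_power_dvd) (use that in simp)
    then have "2 ^ (a + 1) dvd v - 2 ^ b"
      using that(3) by (meson dvd_trans le_imp_power_dvd le_add1 power_le_dvd)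
    then have "2 ^ (a + 1) dvd (v - 2 ^ b) + 2 ^ b - (v - 2 ^ a)"
      by (rule dvd_diff[OF dvd_add[OF _ pb] that(2)])
    then have "(2::int) ^ (a + 1) dvd 2 ^ a"
      by simp
    then have "(2::int) ^ (a + 1) \<le> 2 ^ a"
      by (rule zdvd_imp_le) simp
    then show False
      by simp
  qed
  show ?thesis
    using no_less[of m n] no_less[of n m] assms by (metis linorder_neqE_nat)
qed

lemma bounded_degree_dyadic: "bounded_degree (P_graph (dyadic_pairs S))"
proof -
  have "finite (neighbors (P_graph (dyadic_pairs S)) v) \<and>
      degree (P_graph (dyadic_pairs S)) v \<le> 4" for v
  proof -
    let ?N = "neighbors (P_graph (dyadic_pairs S)) v"
    \<comment> \<open>For \<open>v = 0\<close> there is no such \<open>m\<close>; then only the two path edges end at \<open>v\<close>, and any value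
      of \<open>k\<close> serves.\<close>
    define k :: int where "k = 2 ^ ((THE m. (2::int) ^ (m + 1) dvd v - 2 ^ m) + 1)"
    have "?N \<subseteq> {v - 1, v + 1, v - k, v + k}"
    proof
      fix w assume "w \<in> ?N"
      then consider "\<bar>w - v\<bar> = 1"
        | m where "\<bar>w - v\<bar> = 2 ^ (m + 1)" "(2::int) ^ (m + 1) dvd v - 2 ^ m"
        unfolding neighbors_dyadic by blast
      then show "w \<in> {v - 1, v + 1, v - k, v + k}"
      proof cases
        case 1
        then show ?thesis by auto
      next
        case 2
        then have "(THE m. (2::int) ^ (m + 1) dvd v - 2 ^ m) = m"
          using dyadic_class_unique by blast
        then have "\<bar>w - v\<bar> = k"
          using 2 by (simp add: k_def)
        then show ?thesis by auto
      qed
    qed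
    then have "finite ?N" and "card ?N \<le> card {v - 1, v + 1, v - k, v + k}"
      by (rule finite_subset card_mono[rotated]; simp)+
    moreover have "card {v - 1, v + 1, v - k, v + k} \<le> 4"
      using card_length[of "[v - 1, v + 1, v - k, v + k]"] by simp
    ultimately show ?thesis
      by (simp add: degree_def)
  qed
  then show ?thesis
    unfolding bounded_degree_def by blast
qed

lemma dyadic_edge_iff:
  "3 * 2 ^ m \<in> neighbors (P_graph (dyadic_pairs S)) (2 ^ m) \<longleftrightarrow> m \<in> S"
proof -
  have dist: "\<bar>3 * 2 ^ m - 2 ^ m\<bar> = (2::int) ^ (m + 1)"
    by simp
  have not_path: "(2::int) ^ (m + 1) \<noteq> 1"
    using one_less_power[of "2::int" "m + 1"] by simp
  show ?thesis
    unfolding neighbors_dyadic mem_Collect_eq dist using not_path by auto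
qed

lemma uncountable_P_family: "uncountable P_family"
proof
  let ?G = "\<lambda>S. P_graph (dyadic_pairs S)"
  assume "countable P_family"
  moreover have "range ?G \<subseteq> P_family"
    using dyadic_pairs_subset bounded_degree_dyadic by (auto simp: P_family_def)
  ultimately have "countable (range ?G)"
    by (rule countable_subset[rotated])
  moreover have "inj ?G"
  proof (rule injI)
    fix S T assume "?G S = ?G T"
    then show "S = T"
      using dyadic_edge_iff[of _ S] dyadic_edge_iff[of _ T] by auto
  qed
  ultimately have "countable (UNIV :: nat set set)"
    by (rule countable_image_inj_on)
  then obtain f :: "nat \<Rightarrow> nat set" where "range f = UNIV"
    by (metis UNIV_not_empty uncountable_def)
  then show False
    using Cantors_theorem[of "UNIV :: nat set"] by auto
qed

theorem corollary10:
  "uncountable P_family \<and> (\<forall>G\<in>P_family. harmonic_labeling G (id :: int \<Rightarrow> int))"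
  using uncountable_P_family harmonic_labeling_P_graph by (auto simp: P_family_def)

end
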